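(* Let $p\ge2$, let $\varepsilon=-1$ if $p=3$ and $\varepsilon=1$ otherwise, and let $\mathbf v=(a,x,b,y)^T$ and $\mathbf v'=(a',x',b',y')^T$ be vectors in $H_1(F;\mathbb Z)\cong\mathbb Z^4$. Put $s=ap+\varepsilon b$, $s'=a'p+\varepsilon b'$, $\delta=bs+xyp$, $\delta'=b's'+x'y'p$, and assume $\delta\ne0$ and $\delta'\neq0$. Suppose there is a matrix $g_*$ induced by an element of the Goeritz group $\mathcal G_p$ with $g_*\mathbf v=\mathbf v'$; write $$g_*=\omega\begin{pmatrix} kp+1&\ell&\varepsilon(k-\Delta n)&\varepsilon\Delta m\\ mp&np+\Delta&\varepsilon m&0\\ 0&0&\Delta np+1&-\Delta mp\\ 0&0&-\Delta\ell&\Delta(kp+1)\end{pmatrix}$$ with $k,\ell,m,n\in\mathbb Z$, $\omega\in\{\pm1\}$, $\Delta=\det\begin{pmatrix}kp+1&\ell\\ mp&np+\Delta\end{pmatrix}\in\{\pm1\}$, and put $$c=\frac{\Delta bx'-b'x}{\delta},\quad d=\frac{bs'+\Delta xy'p}{\delta},\quad e=\frac{b's+\Delta x'yp}{\delta},\quad f=\frac{ys'-\Delta y's}{\delta}.$$ Then at least one of the following holds: 1. $(a',x',b',y')^T=\omega(a,\Delta x,b,\Delta y)^T$; 2. $(a',x',b',y')^T=\omega(a+\ell x,\Delta x,b,\Delta(y-\ell b))^T$ for some integer $\ell\ne0$; 3. $(a',x',b',y')^T=\omega(a+\Delta\varepsilon my,\Delta x+ms,b-\Delta mpy,\Delta y)^T$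 for some integer $m\neq0$; 4. $(a',x',b',y')^T=(\omega(a+cfs)+fx+\varepsilon cy,\ \Delta(\omega x+cs),\ \omega b-cpy,\ \Delta(\omega(cfp+1)y-fb))^T$; 5. $p=2$, at least one of $c$ or $f$ is zero, and $(a',x',b',y')^T=(-\omega a+fx+cy,\ -\Delta(\omega x-cs),\ -\omega b-2cy,\ -\Delta(\omega y+fb))^T$; 6. $(a',x',b',y')^T=\left(da+fx+\varepsilon\left(\tfrac{d-e}{p}\right)b+\varepsilon cy,\ \Delta(ex+cs),\ eb-cpy,\ \Delta(dy-fb)\right)^T$, and $|cp|\le2|d|$ or $p|f|\le2|e|$; 7. $(a',x',b',y')^T=(\omega(a+x)+\varepsilon c(y-b),\ \Delta((cp+\omega)x+cs),\ (cp+\omega)b-cpy,\ \Delta\omega(y-b))^T$.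
   Context: Let $p\ge2$. Let $(F',V',W')$ be the genus one Heegaard splitting of the lens space $L(p,1)$ with the $(p,1)$-torus knot bounding a disk in the solid torus $V'$, and let $(F,V,W)$ be its genus-2 stabilization. The Goeritz group $\mathcal G_p$ is the group of isotopy classes of orientation-preserving self-homeomorphisms of $L(p,1)$ preserving the splitting $(F,V,W)$ (each of $V$ and $W$) set-wise. By a theorem of Cho (which may be used), $\mathcal G_p$ has the presentation: - $p=2$: $\langle\beta,\rho,\gamma\mid\rho^4=\gamma^2=(\gamma\rho)^2=\rho^2\beta\rho^2\beta^{-1}=1\rangle$; - $p=3$: $\langle\alpha\mid\alpha^2=1\rangle\oplus\langle\beta,\delta,\gamma\mid\delta^3=\gamma^2=(\gamma\delta)^2=1\rangle$; - $p\ge4$: $\langle\alpha\mid\alpha^2=1\rangle\oplus\langle\beta,\gamma,\sigma\mid\gamma^2=\sigma^2=1\rangle$, where the generators are specific homeomorphisms. (The generator $\delta$ for $p=3$ is unrelated to the integer $\delta$ in the claim.) $H_1(F;\mathbb Z)\cong\mathbb Z^4$ has an ordered basis $\mathbf a,\mathbf x,\mathbf b,\mathbf y$ represented by oriented curves $a,x,b,y$ on $F$, where $a$ and $x$ bound disks in $W$, $y$ bounds a disk in $V$, $a$ meets $b$ once, $x$ meets $y$ once, the other pairs are disjoint, and the cross products of tangent vectors $a\times b$ and $x\times y$ point into $V$. A vector $(a,x,b,y)^T$ denotes coordinates in this basis. The star map $*:\mathcal G_p\to GL(4,\mathbb Z)$, $g\mapsto g_*$, is the induced action on $H_1(F;\mathbb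 Z)$ in this basis. It is given on generators by $$\alpha_*=-I_4,\quad \beta_*=\mathrm{diag}(1,-1,1,-1),\quad \gamma_*=\begin{pmatrix}1&1&0&0\\0&-1&0&0\\0&0&1&0\\0&0&1&-1\end{pmatrix},\quad \delta_*=\begin{pmatrix}-2&-1&1&-1\\3&1&-1&0\\0&0&1&-3\\0&0&1&-2\end{pmatrix},$$ $$\rho_*=\begin{pmatrix}1&1&1&-1\\-2&-1&-1&0\\0&0&-1&2\\0&0&-1&1\end{pmatrix},\quad \sigma_*=\begin{pmatrix}1&0&0&1\\-p&-1&-1&0\\0&0&1&-p\\0&0&0&-1\end{pmatrix}.$$ Every matrix $g_*$ with $g\in\mathcal G_p$ can be written in the form displayed in the claim. In items 2 and 3, $\ell$ and $m$ are existentially quantified integers. *)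

theory Defs
  imports "HOL-Analysis.Analysis" "HOL-Homology.Homology"
begin

section \<open>The lens space \<open>L(p,1)\<close>\<close>

text \<open>\<open>L(p,1)\<close> is the quotient of the unit sphere of \<open>\<complex>\<^sup>2\<close> by the diagonal action of the \<open>p\<close>-th
  roots of unity; its points are the orbits.\<close>

type_synonym lens_point = "(complex \<times> complex) set"

definition lens_orbit :: "nat \<Rightarrow> complex \<times> complex \<Rightarrow> lens_point" where
  "lens_orbit p z = {(\<zeta> * fst z, \<zeta> * snd z) | \<zeta>. \<zeta> ^ p = 1}"

definition lens_space :: "nat \<Rightarrow> lens_point topology" where
  "lens_space p = topology (\<lambda>U. U \<subseteq> lens_orbit p ` sphere 0 1 \<and>
     openin (top_of_set (sphere 0 1)) {z \<in> sphere 0 1. lens_orbit p z \<in> U})"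

lemma openin_lens_space:
  "openin (lens_space p) U \<longleftrightarrow> U \<subseteq> lens_orbit p ` sphere 0 1 \<and>
     openin (top_of_set (sphere 0 1)) {z \<in> sphere 0 1. lens_orbit p z \<in> U}"
proof -
  let ?P = "\<lambda>U. U \<subseteq> lens_orbit p ` sphere 0 1 \<and>
     openin (top_of_set (sphere 0 1)) {z \<in> sphere 0 1. lens_orbit p z \<in> U}"
  have "istopology ?P"
    unfolding istopology_def
  proof (intro conjI allI impI)
    fix S T assume S: "?P S" and T: "?P T"
    then show "S \<inter> T \<subseteq> lens_orbit p ` sphere 0 1" by blast
    have "{z \<in> sphere 0 1. lens_orbit p z \<in> S \<inter> T} =
      {z \<in> sphere 0 1. lens_orbit p z \<in> S} \<inter> {z \<in> sphere 0 1. lens_orbit p z \<in> T}"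
      by blast
    then show "openin (top_of_set (sphere 0 1)) {z \<in> sphere 0 1. lens_orbit p z \<in> S \<inter> T}"
      using S T by (simp add: openin_Int)
  next
    fix K assume K: "\<forall>S\<in>K. ?P S"
    then show "\<Union>K \<subseteq> lens_orbit p ` sphere 0 1" by blast
    have "{z \<in> sphere 0 1. lens_orbit p z \<in> \<Union>K} =
      \<Union>((\<lambda>S. {z \<in> sphere 0 1. lens_orbit p z \<in> S}) ` K)"
      by blast
    then show "openin (top_of_set (sphere 0 1)) {z \<in> sphere 0 1. lens_orbit p z \<in> \<Union>K}"
      using K by (auto intro!: openin_Union)
  qed
  then show ?thesis
    unfolding lens_space_def by (simp add: topology_inverse')
qed

lemma quotient_map_lens_orbit:
  "quotient_map (top_of_set (sphere 0 1)) (lens_space p) (lens_orbit p)"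
proof -
  have "openin (lens_space p) (lens_orbit p ` sphere 0 1)"
  proof -
    have "{z \<in> sphere 0 1. lens_orbit p z \<in> lens_orbit p ` sphere 0 1} = sphere 0 1"
      by blast
    then show ?thesis
      by (simp add: openin_lens_space)
  qed
  then have "topspace (lens_space p) = lens_orbit p ` sphere 0 1"
    by (meson openin_lens_space openin_subset openin_topspace subset_antisym)
  then show ?thesis
    by (simp add: quotient_map_def openin_lens_space)
qed

section \<open>The genus-2 splitting\<close>

text \<open>The genus one splitting is the Clifford torus splitting. In \<open>H\<^sub>1\<close> of the common boundary
  torus the classes \<open>(1,0)\<close>, \<open>(0,1)\<close>, \<open>(1/p,1/p)\<close> (in the two angular coordinates) are the
  meridian \<open>\<mu>\<close> of \<open>lens_W1\<close>, the meridian of \<open>lens_V1\<close>, and a longitude \<open>\<lambda>\<close> of \<open>lens_W1\<close>. Since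
  \<open>(0,1) = p\<lambda> - \<mu>\<close>, the curve bounding a disk in \<open>lens_V1\<close> is the \<open>(p,1)\<close>-torus knot of \<open>lens_W1\<close>
  (up to the choice of the direction of \<open>\<mu>\<close>).\<close>

definition lens_V1 :: "nat \<Rightarrow> lens_point set" where
  "lens_V1 p = lens_orbit p ` {z \<in> sphere 0 1. cmod (snd z) \<le> cmod (fst z)}"

definition lens_W1 :: "nat \<Rightarrow> lens_point set" where
  "lens_W1 p = lens_orbit p ` {z \<in> sphere 0 1. cmod (fst z) \<le> cmod (snd z)}"

text \<open>The distance from the core semicircle \<open>{u. u\<^sub>1\<^sup>2 + u\<^sub>3\<^sup>2 = 1, u\<^sub>2 = 0, u\<^sub>3 \<ge> 0}\<close> of an unknotted
  1-handle attached to the half space \<open>u\<^sub>3 \<le> 0\<close>.\<close>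

definition handle_dist :: "real^3 \<Rightarrow> real" where
  "handle_dist u = sqrt ((sqrt ((u$1)\<^sup>2 + (u$3)\<^sup>2) - 1)\<^sup>2 + (u$2)\<^sup>2)"

text \<open>\<open>(V,W)\<close> is a stabilization of the genus one splitting: inside a ball \<open>h ` cball 0 2\<close> meeting
  the torus in a flat disk, an unknotted handle is moved from \<open>lens_W1\<close> to \<open>lens_V1\<close>; outside the
  ball nothing changes. The Heegaard surface is \<open>V \<inter> W\<close>.\<close>

definition genus2_stabilization :: "nat \<Rightarrow> lens_point set \<Rightarrow> lens_point set \<Rightarrow> bool" where
  "genus2_stabilization p V W \<longleftrightarrow>
     V \<subseteq> topspace (lens_space p) \<and> W \<subseteq> topspace (lens_space p) \<and>
     (\<exists>h :: real^3 \<Rightarrow> lens_point.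
        embedding_map (top_of_set (cball 0 2)) (lens_space p) h \<and>
        (\<forall>u \<in> cball 0 2.
           (h u \<in> lens_V1 p \<longleftrightarrow> u$3 \<le> 0) \<and>
           (h u \<in> lens_W1 p \<longleftrightarrow> u$3 \<ge> 0) \<and>
           (h u \<in> V \<longleftrightarrow> u$3 \<le> 0 \<or> handle_dist u \<le> 1/4) \<and>
           (h u \<in> W \<longleftrightarrow> u$3 \<ge> 0 \<and> handle_dist u \<ge> 1/4)) \<and>
        (\<forall>q \<in> topspace (lens_space p) - h ` cball 0 2.
           (q \<in> V \<longleftrightarrow> q \<in> lens_V1 p) \<and> (q \<in> W \<longleftrightarrow> q \<in> lens_W1 p)))"

definition heegaard_surface :: "nat \<Rightarrow> lens_point set \<Rightarrow> lens_point set \<Rightarrow> lens_point topology" where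
  "heegaard_surface p V W = subtopology (lens_space p) (V \<inter> W)"

section \<open>The Goeritz group\<close>

text \<open>Orientation preserving is expressed as acting trivially on \<open>H\<^sub>3(L(p,1); \<int>)\<close>. Functions are
  total on the type of points; their values off the lens space are irrelevant and are identified
  by the isotopy relation.\<close>

definition splitting_homeos ::
    "nat \<Rightarrow> lens_point set \<Rightarrow> lens_point set \<Rightarrow> (lens_point \<Rightarrow> lens_point) set" where
  "splitting_homeos p V W = {f. homeomorphic_map (lens_space p) (lens_space p) f \<and>
     (\<forall>c \<in> carrier (homology_group 3 (lens_space p)).
        hom_induced 3 (lens_space p) {} (lens_space p) {} f c = c) \<and>
     f ` V = V \<and> f ` W = W}"

text \<open>An isotopy is a homotopy each of whose stages is a homeomorphism preserving the splitting.\<close>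

definition splitting_isotopic ::
    "nat \<Rightarrow> lens_point set \<Rightarrow> lens_point set \<Rightarrow>
     (lens_point \<Rightarrow> lens_point) \<Rightarrow> (lens_point \<Rightarrow> lens_point) \<Rightarrow> bool" where
  "splitting_isotopic p V W =
     homotopic_with (\<lambda>f. f \<in> splitting_homeos p V W) (lens_space p) (lens_space p)"

definition isotopy_class ::
    "nat \<Rightarrow> lens_point set \<Rightarrow> lens_point set \<Rightarrow>
     (lens_point \<Rightarrow> lens_point) \<Rightarrow> (lens_point \<Rightarrow> lens_point) set" where
  "isotopy_class p V W f = {g. splitting_isotopic p V W f g}"

definition goeritz_group ::
    "nat \<Rightarrow> lens_point set \<Rightarrow> lens_point set \<Rightarrow> (lens_point \<Rightarrow> lens_point) set monoid" where
  "goeritz_group p V W =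
     \<lparr>carrier = isotopy_class p V W ` splitting_homeos p V W,
      mult = (\<lambda>A B. \<Union>f\<in>A. \<Union>g\<in>B. isotopy_class p V W (f \<circ> g)),
      one = isotopy_class p V W id\<rparr>"

section \<open>Group presentations\<close>

text \<open>The letter \<open>(g, True)\<close> stands for the generator \<open>g\<close>, the letter \<open>(g, False)\<close> for its inverse.\<close>

type_synonym 'g word = "('g \<times> bool) list"

definition word_value :: "('a, 'b) monoid_scheme \<Rightarrow> ('g \<Rightarrow> 'a) \<Rightarrow> 'g word \<Rightarrow> 'a" where
  "word_value G \<iota> w =
     foldr (\<lambda>(g, pos) h. (if pos then \<iota> g else inv\<^bsub>G\<^esub> (\<iota> g)) \<otimes>\<^bsub>G\<^esub> h) w \<one>\<^bsub>G\<^esub>"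

text \<open>The words over \<open>S\<close> representing the identity of \<open>\<langle>S | R\<rangle>\<close>: those obtained from the empty
  word by inserting and deleting relators and subwords \<open>gg\<^sup>-\<^sup>1\<close>, \<open>g\<^sup>-\<^sup>1g\<close>.\<close>

inductive trivial_word :: "'g set \<Rightarrow> 'g word set \<Rightarrow> 'g word \<Rightarrow> bool"
  for S :: "'g set" and R :: "'g word set" where
  empty: "trivial_word S R []"
| insert_cancelling: "g \<in> S \<Longrightarrow> trivial_word S R (u @ v) \<Longrightarrow>
    trivial_word S R (u @ [(g, pos), (g, \<not> pos)] @ v)"
| delete_cancelling: "trivial_word S R (u @ [(g, pos), (g, \<not> pos)] @ v) \<Longrightarrow>
    trivial_word S R (u @ v)"
| insert_relator: "r \<in> R \<Longrightarrow> trivial_word S R (u @ v) \<Longrightarrow> trivial_word S R (u @ r @ v)"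
| delete_relator: "r \<in> R \<Longrightarrow> trivial_word S R (u @ r @ v) \<Longrightarrow> trivial_word S R (u @ v)"

definition has_presentation ::
    "('a, 'b) monoid_scheme \<Rightarrow> 'g set \<Rightarrow> 'g word set \<Rightarrow> ('g \<Rightarrow> 'a) \<Rightarrow> bool" where
  "has_presentation G S R \<iota> \<longleftrightarrow>
     group G \<and> \<iota> ` S \<subseteq> carrier G \<and> generate G (\<iota> ` S) = carrier G \<and>
     (\<forall>w. set w \<subseteq> S \<times> UNIV \<longrightarrow> (word_value G \<iota> w = \<one>\<^bsub>G\<^esub> \<longleftrightarrow> trivial_word S R w))"

section \<open>Cho's presentation and the matrices of the generators\<close>

datatype goeritz_gen = Alpha | Beta | Gamma | Delta | Rho | Sigma

definition goeritz_gens :: "nat \<Rightarrow> goeritz_gen set" where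
  "goeritz_gens p =
     (if p = 2 then {Beta, Rho, Gamma}
      else if p = 3 then {Alpha, Beta, Delta, Gamma}
      else {Alpha, Beta, Gamma, Sigma})"

definition commutator_word :: "'g \<Rightarrow> 'g \<Rightarrow> 'g word" where
  "commutator_word g h = [(g, True), (h, True), (g, False), (h, False)]"

text \<open>The direct summand \<open>\<langle>\<alpha> | \<alpha>\<^sup>2\<rangle>\<close> contributes the commutators of \<open>\<alpha>\<close> with the other generators.\<close>

definition goeritz_relators :: "nat \<Rightarrow> goeritz_gen word set" where
  "goeritz_relators p =
     (if p = 2 then
        {replicate 4 (Rho, True),
         [(Gamma, True), (Gamma, True)],
         [(Gamma, True), (Rho, True), (Gamma, True), (Rho, True)],
         [(Rho, True), (Rho, True), (Beta, True), (Rho, True), (Rho, True), (Beta, False)]}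
      else if p = 3 then
        {[(Alpha, True), (Alpha, True)],
         commutator_word Alpha Beta, commutator_word Alpha Delta, commutator_word Alpha Gamma,
         replicate 3 (Delta, True),
         [(Gamma, True), (Gamma, True)],
         [(Gamma, True), (Delta, True), (Gamma, True), (Delta, True)]}
      else
        {[(Alpha, True), (Alpha, True)],
         commutator_word Alpha Beta, commutator_word Alpha Gamma, commutator_word Alpha Sigma,
         [(Gamma, True), (Gamma, True)],
         [(Sigma, True), (Sigma, True)]})"

fun goeritz_gen_matrix :: "nat \<Rightarrow> goeritz_gen \<Rightarrow> int^4^4" where
  "goeritz_gen_matrix p Alpha = - mat 1"
| "goeritz_gen_matrix p Beta = vector
     [vector [1, 0, 0, 0], vector [0, -1, 0, 0], vector [0, 0, 1, 0], vector [0, 0, 0, -1]]"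
| "goeritz_gen_matrix p Gamma = vector
     [vector [1, 1, 0, 0], vector [0, -1, 0, 0], vector [0, 0, 1, 0], vector [0, 0, 1, -1]]"
| "goeritz_gen_matrix p Delta = vector
     [vector [-2, -1, 1, -1], vector [3, 1, -1, 0], vector [0, 0, 1, -3], vector [0, 0, 1, -2]]"
| "goeritz_gen_matrix p Rho = vector
     [vector [1, 1, 1, -1], vector [-2, -1, -1, 0], vector [0, 0, -1, 2], vector [0, 0, -1, 1]]"
| "goeritz_gen_matrix p Sigma = vector
     [vector [1, 0, 0, 1], vector [- int p, -1, -1, 0], vector [0, 0, 1, - int p],
      vector [0, 0, 0, -1]]"

section \<open>The basis of \<open>H\<^sub>1(F; \<int>)\<close> and the star map\<close>

definition simple_loop :: "'a topology \<Rightarrow> (real \<Rightarrow> 'a) \<Rightarrow> bool" where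
  "simple_loop X c \<longleftrightarrow>
     continuous_map (top_of_set {0..1}) X c \<and> c 0 = c 1 \<and> inj_on c {0..<1}"

text \<open>The homology class of a loop, viewed as a singular 1-simplex via the barycentric
  coordinate \<open>u 1\<close>.\<close>

definition loop_class :: "'a topology \<Rightarrow> (real \<Rightarrow> 'a) \<Rightarrow> 'a chain set" where
  "loop_class X c = homologous_rel_set 1 X {} (frag_of (restrict (\<lambda>u. c (u 1)) (standard_simplex 1)))"

text \<open>The loop \<open>c\<close> bounds a properly embedded disk in the handlebody \<open>H\<close> with boundary \<open>F\<close>.\<close>

definition bounds_disk :: "'a topology \<Rightarrow> 'a set \<Rightarrow> 'a set \<Rightarrow> (real \<Rightarrow> 'a) \<Rightarrow> bool" where
  "bounds_disk X H F c \<longleftrightarrow>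
     (\<exists>D :: complex \<Rightarrow> 'a. embedding_map (top_of_set (cball 0 1)) (subtopology X H) D \<and>
        D ` ball 0 1 \<inter> F = {} \<and> (\<forall>t \<in> {0..1}. D (cis (2 * pi * t)) = c t))"

definition infinite_cyclic_generator :: "('a, 'b) monoid_scheme \<Rightarrow> 'a \<Rightarrow> bool" where
  "infinite_cyclic_generator G c \<longleftrightarrow>
     c \<in> carrier G \<and> bij_betw (\<lambda>n::int. c [^]\<^bsub>G\<^esub> n) UNIV (carrier G)"

text \<open>\<open>\<mu>\<close> is the orientation of \<open>L(p,1)\<close> (a generator of \<open>H\<^sub>3\<close>) and \<open>\<tau>\<close> that of \<open>\<real>\<^sup>3\<close> (a generator of the
  local homology at \<open>0\<close>). The loops \<open>c\<close>, \<open>c'\<close> meet once, and there is an orientation preserving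
  chart around the intersection point in which \<open>V\<close> is the half space \<open>u\<^sub>3 \<ge> 0\<close> and \<open>c\<close>, \<open>c'\<close> run
  along the first and second axis in positive direction; so \<open>c \<times> c'\<close> points into \<open>V\<close>.\<close>

definition positive_crossing ::
    "nat \<Rightarrow> lens_point set \<Rightarrow> lens_point set \<Rightarrow>
     lens_point chain set \<Rightarrow> (real^3) chain set \<Rightarrow>
     (real \<Rightarrow> lens_point) \<Rightarrow> (real \<Rightarrow> lens_point) \<Rightarrow> bool" where
  "positive_crossing p V W \<mu> \<tau> c c' \<longleftrightarrow>
     (\<exists>h :: real^3 \<Rightarrow> lens_point.
        embedding_map euclidean (lens_space p) h \<and> openin (lens_space p) (range h) \<and>
        hom_induced 3 (lens_space p) {} (lens_space p) (topspace (lens_space p) - {h 0}) id \<mu> =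
          hom_induced 3 euclidean (UNIV - {0}) (lens_space p) (topspace (lens_space p) - {h 0}) h \<tau> \<and>
        (\<forall>u. (h u \<in> V \<longleftrightarrow> u$3 \<ge> 0) \<and> (h u \<in> W \<longleftrightarrow> u$3 \<le> 0)) \<and>
        c ` {0..1} \<inter> c' ` {0..1} = {h 0} \<and>
        (\<exists>t t' r. r > 0 \<and> (\<forall>q. \<bar>q\<bar> < r \<longrightarrow>
           c (frac (t + q)) = h (axis 1 q) \<and> c' (frac (t' + q)) = h (axis 2 q))))"

definition lin_comb :: "('a, 'b) monoid_scheme \<Rightarrow> (4 \<Rightarrow> 'a) \<Rightarrow> int^4 \<Rightarrow> 'a" where
  "lin_comb G B v = finprod G (\<lambda>i. B i [^]\<^bsub>G\<^esub> (v$i)) UNIV"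

definition ordered_basis :: "('a, 'b) monoid_scheme \<Rightarrow> (4 \<Rightarrow> 'a) \<Rightarrow> bool" where
  "ordered_basis G B \<longleftrightarrow> range B \<subseteq> carrier G \<and> bij_betw (lin_comb G B) UNIV (carrier G)"

definition surface_basis ::
    "nat \<Rightarrow> lens_point set \<Rightarrow> lens_point set \<Rightarrow> (4 \<Rightarrow> lens_point chain set) \<Rightarrow> bool" where
  "surface_basis p V W B \<longleftrightarrow>
     ordered_basis (homology_group 1 (heegaard_surface p V W)) B \<and>
     (\<exists>\<mu> \<tau> a x b y.
        infinite_cyclic_generator (homology_group 3 (lens_space p)) \<mu> \<and>
        infinite_cyclic_generator (relative_homology_group 3 euclidean (UNIV - {0})) \<tau> \<and>
        (\<forall>c \<in> {a, x, b, y}. simple_loop (heegaard_surface p V W) c) \<and>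
        B 1 = loop_class (heegaard_surface p V W) a \<and>
        B 2 = loop_class (heegaard_surface p V W) x \<and>
        B 3 = loop_class (heegaard_surface p V W) b \<and>
        B 4 = loop_class (heegaard_surface p V W) y \<and>
        bounds_disk (lens_space p) W (V \<inter> W) a \<and>
        bounds_disk (lens_space p) W (V \<inter> W) x \<and>
        bounds_disk (lens_space p) V (V \<inter> W) y \<and>
        positive_crossing p V W \<mu> \<tau> a b \<and>
        positive_crossing p V W \<mu> \<tau> x y \<and>
        a ` {0..1} \<inter> x ` {0..1} = {} \<and>
        a ` {0..1} \<inter> y ` {0..1} = {} \<and>
        b ` {0..1} \<inter> x ` {0..1} = {} \<and>
        b ` {0..1} \<inter> y ` {0..1} = {})"

text \<open>The matrix of the action on \<open>H\<^sub>1(F; \<int>)\<close>: column \<open>j\<close> holds the coordinates of the image of the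
  \<open>j\<close>-th basis vector.\<close>

definition star_map ::
    "nat \<Rightarrow> lens_point set \<Rightarrow> lens_point set \<Rightarrow> (4 \<Rightarrow> lens_point chain set) \<Rightarrow>
     (lens_point \<Rightarrow> lens_point) set \<Rightarrow> int^4^4" where
  "star_map p V W B g = (THE M. \<forall>f \<in> g. \<forall>j.
     hom_induced 1 (heegaard_surface p V W) {} (heegaard_surface p V W) {} f (B j) =
       lin_comb (homology_group 1 (heegaard_surface p V W)) B (column j M))"

end

theory Submission
  imports Defs
begin

text \<open>Case 6 always holds. Solving \<open>g\<^sub>* v = v'\<close> gives \<open>c = \<omega>\<Delta>m\<close>, \<open>d = \<omega>(kp + 1)\<close>, \<open>e = \<omega>(\<Delta>np + 1)\<close> and
  \<open>f = \<omega>\<ell>\<close>, so that the formula of case 6 is the equation itself, and its inequalities say that the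
  first column \<open>(u, v)\<close> of the upper left block satisfies \<open>\<bar>v\<bar> \<le> 2\<bar>u\<bar>\<close> or the second one satisfies
  \<open>p\<bar>u\<bar> \<le> 2\<bar>v\<bar>\<close>. For \<open>p \<le> 3\<close> the determinant condition forces this. For \<open>p \<ge> 4\<close> the upper left
  blocks of the generators are, up to signs, powers of the elementary matrices \<open>T = (1 1; 0 1)\<close> and
  \<open>L = (1 0; p 1)\<close>, whose nonzero powers play ping-pong with the two cones: \<open>L\<^sup>r\<close> maps the first
  into the second and \<open>T\<^sup>r\<close> the second into the first. The block of a word starting with \<open>T\<close> thus
  has its first column in the first cone, and that of a word starting with \<open>L\<close> its second column
  in the second cone.\<close>

lemma vector_4 [simp]:
  "(vector [w, x, y, z] :: 'a::zero^4) $ 1 = w"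
  "(vector [w, x, y, z] :: 'a^4) $ 2 = x"
  "(vector [w, x, y, z] :: 'a^4) $ 3 = y"
  "(vector [w, x, y, z] :: 'a^4) $ 4 = z"
  unfolding vector_def by simp_all

section \<open>Linear combinations in an abelian group\<close>

lemma lin_comb_4:
  fixes G (structure)
  assumes "comm_group G" "range B \<subseteq> carrier G"
  shows "lin_comb G B v = B 1 [^] v$1 \<otimes> (B 2 [^] v$2 \<otimes> (B 3 [^] v$3 \<otimes> B 4 [^] v$4))"
proof -
  interpret comm_group G by fact
  have "B i \<in> carrier G" for i
    using assms by blast
  then show ?thesis
    unfolding lin_comb_def UNIV_4 by simp
qed

lemma lin_comb_add:
  fixes G (structure)
  assumes "comm_group G" "range B \<subseteq> carrier G"
  shows "lin_comb G B (v + w) = lin_comb G B v \<otimes> lin_comb G B w"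
proof -
  interpret comm_group G by fact
  have B: "B i \<in> carrier G" for i
    using assms by blast
  have "B i [^] (v + w)$i = B i [^] v$i \<otimes> B i [^] w$i" for i
    by (simp add: B int_pow_mult)
  then show ?thesis
    unfolding lin_comb_def by (simp add: B finprod_multf)
qed

lemma lin_comb_scale:
  fixes G (structure)
  assumes "comm_group G" "range B \<subseteq> carrier G"
  shows "lin_comb G B (r *s v) = lin_comb G B v [^] r"
proof -
  interpret comm_group G by fact
  have B: "B i \<in> carrier G" for i
    using assms by blast
  have *: "B i [^] (r *s v)$i = (B i [^] v$i) [^] r" for i
    by (simp add: B int_pow_pow mult.commute)
  show ?thesis
    unfolding lin_comb_4[OF assms] * by (simp add: B int_pow_distrib)
qed

text \<open>\<open>M *v v\<close> is the combination of the columns of \<open>M\<close> with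
  coefficients \<open>v\<close>, so both sides expand to the same product of powers of the images of
  the basis elements.\<close>

lemma hom_lin_comb:
  fixes G (structure)
  assumes G: "comm_group G" and B: "range B \<subseteq> carrier G" and \<phi>: "\<phi> \<in> hom G G"
    and M: "\<And>j. \<phi> (B j) = lin_comb G B (column j M)"
  shows "\<phi> (lin_comb G B v) = lin_comb G B (M *v v)"
proof -
  interpret comm_group G by fact
  interpret group_hom G G \<phi>
    using \<phi> by (simp add: group_hom_def group_hom_axioms_def)
  have Bc: "B i \<in> carrier G" for i
    using B by blast
  have "M *v v = v$1 *s column 1 M + (v$2 *s column 2 M + (v$3 *s column 3 M + v$4 *s column 4 M))"
    by (simp add: vec_eq_iff matrix_vector_mult_def column_def sum_4 mult.commute)
  then have "lin_comb G B (M *v v) =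
      \<phi> (B 1) [^] v$1 \<otimes> (\<phi> (B 2) [^] v$2 \<otimes> (\<phi> (B 3) [^] v$3 \<otimes> \<phi> (B 4) [^] v$4))"
    by (simp add: lin_comb_add[OF G B] lin_comb_scale[OF G B] M)
  then show ?thesis
    by (simp add: lin_comb_4[OF G B] Bc hom_int_pow)
qed

text \<open>Supplies the existence and uniqueness that make the \<open>THE\<close> in
  \<open>star_map\<close> meaningful.\<close>

lemma ordered_basis_ex1_matrix:
  assumes "ordered_basis G B" "\<And>j. c j \<in> carrier G"
  shows "\<exists>!M. \<forall>j. c j = lin_comb G B (column j M)"
proof -
  have bij: "bij_betw (lin_comb G B) UNIV (carrier G)"
    using assms(1) by (simp add: ordered_basis_def)
  have "\<forall>j. \<exists>v. c j = lin_comb G B v"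
    using bij assms(2) by (metis bij_betw_imp_surj_on imageE)
  then obtain v where v: "c j = lin_comb G B (v j)" for j
    by metis
  show ?thesis
  proof
    show "\<forall>j. c j = lin_comb G B (column j (\<chi> i k. v k $ i))"
      by (simp add: v column_def)
  next
    fix M
    assume "\<forall>j. c j = lin_comb G B (column j M)"
    then have "column j M = v j" for j
      using bij v by (metis bij_betw_imp_inj_on injD)
    then show "M = (\<chi> i k. v k $ i)"
      by (simp add: vec_eq_iff column_def)
  qed
qed

section \<open>The star map is a homomorphism\<close>

text \<open>Every stage preserves \<open>S\<close>, so the homotopy restricts to \<open>S\<close>.
  This turns an isotopy of the splitting into a homotopy on the Heegaard surface, where homotopy
  invariance of homology applies.\<close>

lemma homotopic_with_subtopology:
  assumes "homotopic_with P X X f g" and P: "\<And>h. P h \<Longrightarrow> h ` S \<subseteq> S"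
  shows "homotopic_with (\<lambda>h. True) (subtopology X S) (subtopology X S) f g"
proof -
  obtain h where h: "continuous_map (prod_topology (top_of_set {0..1::real}) X) X h"
    and "\<forall>x. h (0, x) = f x" "\<forall>x. h (1, x) = g x" and Ph: "\<forall>t\<in>{0..1}. P (\<lambda>x. h (t, x))"
    using assms(1) by (auto simp: homotopic_with_def)
  moreover have "continuous_map (prod_topology (top_of_set {0..1::real}) (subtopology X S)) (subtopology X S) h"
  proof -
    have "h ` ({0..1} \<times> S) \<subseteq> S"
      using P Ph by fastforce
    then show ?thesis
      using h
      by (auto simp: prod_topology_subtopology(2) continuous_map_in_subtopology
          intro: continuous_map_from_subtopology)
  qed
  ultimately show ?thesis
    by (auto simp: homotopic_with_def)
qed

lemma splitting_homeos_continuous_surface: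
  assumes "f \<in> splitting_homeos p V W"
  shows "continuous_map (heegaard_surface p V W) (heegaard_surface p V W) f"
proof -
  have "continuous_map (lens_space p) (lens_space p) f" "f ` (V \<inter> W) \<subseteq> V \<inter> W"
    using assms by (auto simp: splitting_homeos_def homeomorphic_imp_continuous_map)
  then show ?thesis
    unfolding heegaard_surface_def
    by (auto intro: continuous_map_from_subtopology simp: continuous_map_in_subtopology)
qed

lemma splitting_isotopic_hom_induced:
  assumes "splitting_isotopic p V W f g"
  shows "hom_induced q (heegaard_surface p V W) {} (heegaard_surface p V W) {} f =
    hom_induced q (heegaard_surface p V W) {} (heegaard_surface p V W) {} g"
proof -
  have "h ` (V \<inter> W) \<subseteq> V \<inter> W" if "h \<in> splitting_homeos p V W" for h
    using that by (auto simp: splitting_homeos_def)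
  then show ?thesis
    using assms unfolding splitting_isotopic_def heegaard_surface_def
    by (intro homology_homotopy_empty) (rule homotopic_with_subtopology)
qed

lemma splitting_homeos_id: "id \<in> splitting_homeos p V W"
  by (auto simp: splitting_homeos_def hom_induced_id)

lemma splitting_homeos_comp:
  assumes "f \<in> splitting_homeos p V W" "g \<in> splitting_homeos p V W"
  shows "f \<circ> g \<in> splitting_homeos p V W"
proof -
  have "continuous_map (lens_space p) (lens_space p) f" "continuous_map (lens_space p) (lens_space p) g"
    using assms by (auto simp: splitting_homeos_def homeomorphic_imp_continuous_map)
  then show ?thesis
    using assms
    by (auto simp: splitting_homeos_def hom_induced_compose_empty homeomorphic_map_compose
        simp flip: image_image)
qed

lemma isotopy_class_refl:
  assumes "f \<in> splitting_homeos p V W"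
  shows "f \<in> isotopy_class p V W f"
  using assms
  by (simp add: isotopy_class_def splitting_isotopic_def splitting_homeos_def
      homeomorphic_imp_continuous_map)

lemma goeritz_group_member:
  assumes "A \<in> carrier (goeritz_group p V W)" "f \<in> A"
  shows "f \<in> splitting_homeos p V W"
  using assms
  by (auto simp: goeritz_group_def isotopy_class_def splitting_isotopic_def
      dest: homotopic_with_imp_property)

text \<open>\<open>star_map\<close> asks for a matrix that fits all members of a class. They are
  isotopic and induce the same map on homology, so a single representative decides.\<close>

lemma star_map_unique:
  assumes basis: "surface_basis p V W B" and A: "A \<in> carrier (goeritz_group p V W)" and f: "f \<in> A"
  shows "star_map p V W B A = M \<longleftrightarrow> (\<forall>j.
     hom_induced 1 (heegaard_surface p V W) {} (heegaard_surface p V W) {} f (B j) =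
       lin_comb (homology_group 1 (heegaard_surface p V W)) B (column j M))"
proof -
  let ?H = "homology_group 1 (heegaard_surface p V W)"
  let ?ind = "hom_induced 1 (heegaard_surface p V W) {} (heegaard_surface p V W) {}"
  obtain f0 where "A = isotopy_class p V W f0"
    using A by (auto simp: goeritz_group_def)
  then have ind: "?ind h = ?ind f" if "h \<in> A" for h
    using f that splitting_isotopic_hom_induced
    by (metis isotopy_class_def mem_Collect_eq)
  have "\<exists>!M. \<forall>j. ?ind f (B j) = lin_comb ?H B (column j M)"
    using basis by (intro ordered_basis_ex1_matrix) (simp_all add: surface_basis_def hom_induced_carrier)
  then have "\<exists>!M. \<forall>h\<in>A. \<forall>j. ?ind h (B j) = lin_comb ?H B (column j M)"
    using ind f by (smt (verit, best))
  from theI'[OF this] this show ?thesis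
    unfolding star_map_def using ind f by (smt (verit, best))
qed

lemma goeritz_group_one_member: "id \<in> \<one>\<^bsub>goeritz_group p V W\<^esub>"
  by (simp add: goeritz_group_def isotopy_class_refl splitting_homeos_id)

lemma star_map_one:
  assumes "surface_basis p V W B" "group (goeritz_group p V W)"
  shows "star_map p V W B \<one>\<^bsub>goeritz_group p V W\<^esub> = mat 1"
proof -
  let ?H = "homology_group 1 (heegaard_surface p V W)"
  have B: "range B \<subseteq> carrier ?H"
    using assms(1) by (simp add: surface_basis_def ordered_basis_def)
  interpret comm_group ?H
    by simp
  have Bc: "B j \<in> carrier ?H" for j
    using B by blast
  have "B j = lin_comb ?H B (column j (mat 1))" for j
    unfolding lin_comb_4[OF comm_group_axioms B]
    by (rule exhaust_4[of j, THEN disjE])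
       (auto simp: column_def mat_def Bc)
  moreover have "hom_induced 1 (heegaard_surface p V W) {} (heegaard_surface p V W) {} id (B j) = B j" for j
    using Bc by (rule hom_induced_id)
  ultimately show ?thesis
    using star_map_unique[OF assms(1) _ goeritz_group_one_member] assms(2)
    by (metis group.is_monoid monoid.one_closed)
qed

text \<open>The product is a union of classes; the group hypothesis makes it an element of the
  carrier again, so its matrix can be read off the one representative
  \<open>f \<circ> g\<close>.\<close>

lemma star_map_mult:
  assumes basis: "surface_basis p V W B" and "group (goeritz_group p V W)"
    and A: "A \<in> carrier (goeritz_group p V W)" and C: "C \<in> carrier (goeritz_group p V W)"
  shows "star_map p V W B (A \<otimes>\<^bsub>goeritz_group p V W\<^esub> C) = star_map p V W B A ** star_map p V W B C"
proof -
  let ?G = "goeritz_group p V W"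
  let ?F = "heegaard_surface p V W"
  let ?H = "homology_group 1 ?F"
  let ?M = "star_map p V W B A"
  let ?N = "star_map p V W B C"
  interpret group ?G by fact
  obtain f g where f: "f \<in> A" and g: "g \<in> C"
    using A C by (auto simp: goeritz_group_def dest: isotopy_class_refl)
  have fg: "f \<in> splitting_homeos p V W" "g \<in> splitting_homeos p V W"
    using A C f g by (auto intro: goeritz_group_member)
  have fg_mem: "f \<circ> g \<in> A \<otimes>\<^bsub>?G\<^esub> C"
    using f g isotopy_class_refl[OF splitting_homeos_comp[OF fg]] by (auto simp: goeritz_group_def)
  have B: "range B \<subseteq> carrier ?H"
    using basis by (simp add: surface_basis_def ordered_basis_def)
  have M: "hom_induced 1 ?F {} ?F {} f (B j) = lin_comb ?H B (column j ?M)" for j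
    using star_map_unique[OF basis A f] by blast
  have N: "hom_induced 1 ?F {} ?F {} g (B j) = lin_comb ?H B (column j ?N)" for j
    using star_map_unique[OF basis C g] by blast
  have "hom_induced 1 ?F {} ?F {} (f \<circ> g) (B j) = lin_comb ?H B (column j (?M ** ?N))" for j
  proof -
    have "hom_induced 1 ?F {} ?F {} (f \<circ> g) (B j) =
        hom_induced 1 ?F {} ?F {} f (lin_comb ?H B (column j ?N))"
      using fg[THEN splitting_homeos_continuous_surface]
      by (simp add: hom_induced_compose_empty[where Y = ?F] N)
    also have "\<dots> = lin_comb ?H B (?M *v column j ?N)"
      by (rule hom_lin_comb) (simp_all add: B M hom_induced_empty_hom)
    also have "?M *v column j ?N = column j (?M ** ?N)"
      by (simp add: vec_eq_iff column_def matrix_vector_mult_def matrix_matrix_mult_def)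
    finally show ?thesis .
  qed
  then show ?thesis
    using star_map_unique[OF basis _ fg_mem] A C by blast
qed

text \<open>Because the matrices \<open>M h\<close> are involutions, the inverse of a generator acts
  by the same matrix as the generator, and \<open>step\<close> covers both kinds of letters.\<close>

lemma star_map_goeritz_induct:
  assumes basis: "surface_basis p V W B"
    and Cho: "has_presentation (goeritz_group p V W) S R gen"
    and star_gen: "\<And>h. h \<in> S \<Longrightarrow> star_map p V W B (gen h) = M h"
    and invol: "\<And>h. h \<in> S \<Longrightarrow> M h ** M h = mat 1"
    and one: "P (mat 1)"
    and step: "\<And>h N. h \<in> S \<Longrightarrow> P N \<Longrightarrow> P (M h ** N)"
    and g: "g \<in> carrier (goeritz_group p V W)"
  shows "P (star_map p V W B g)"
proof -
  let ?G = "goeritz_group p V W"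
  let ?star = "star_map p V W B"
  have grp: "group ?G" and gen: "gen ` S \<subseteq> carrier ?G" "generate ?G (gen ` S) = carrier ?G"
    using Cho by (auto simp: has_presentation_def)
  interpret group ?G by (fact grp)
  note mult = star_map_mult[OF basis grp]
  \<comment> \<open>\<open>generate\<close> is closed under products of arbitrary elements, not only
    under left multiplication by a generator; quantifying over \<open>N\<close> lets the product
    case compose. \<open>N = mat 1\<close> gives the claim.\<close>
  have "\<forall>N. P N \<longrightarrow> P (?star g ** N)" if "g \<in> generate ?G (gen ` S)" for g
    using that
  proof (induction rule: generate.induct)
    case one
    then show ?case
      by (simp add: star_map_one[OF basis grp])
  next
    case (incl h)
    then show ?case
      using star_gen step by auto
  next
    case (inv h)
    then obtain k where k: "k \<in> S" "h = gen k" "h \<in> carrier ?G"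
      using gen by auto
    have "?star (inv\<^bsub>?G\<^esub> h) ** ?star h = mat 1"
      using k by (simp add: star_map_one[OF basis grp] flip: mult)
    moreover have "?star h = M k"
      using k star_gen by simp
    ultimately have "?star (inv\<^bsub>?G\<^esub> h) = M k"
      using invol[OF k(1)] by (metis matrix_mul_assoc matrix_mul_lid matrix_mul_rid)
    then show ?case
      using k step by simp
  next
    case (eng h1 h2)
    then have "h1 \<in> carrier ?G" "h2 \<in> carrier ?G"
      using gen by auto
    then show ?case
      using eng by (simp add: mult flip: matrix_mul_assoc)
  qed
  then show ?thesis
    using g gen one by (metis matrix_mul_rid)
qed

section \<open>Ping-pong\<close>

text \<open>The matrix \<open>(A B; C D)\<close> is an alternating word in nonzero powers of \<open>T\<close> and \<open>L\<close>, times a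
  diagonal sign matrix; the flag \<open>True\<close> means that the word does not start with \<open>T\<close>, the flag \<open>False\<close>
  that it does not start with \<open>L\<close>.\<close>

inductive alternating :: "int \<Rightarrow> bool \<Rightarrow> int \<Rightarrow> int \<Rightarrow> int \<Rightarrow> int \<Rightarrow> bool" for p where
  diag: "\<bar>s\<bar> = 1 \<Longrightarrow> \<bar>t\<bar> = 1 \<Longrightarrow> alternating p q s 0 0 t"
| upper: "alternating p True A B C D \<Longrightarrow> r \<noteq> 0 \<Longrightarrow> alternating p False (A + r * C) (B + r * D) C D"
| lower: "alternating p False A B C D \<Longrightarrow> r \<noteq> 0 \<Longrightarrow>
    alternating p True A B (C + r * p * A) (D + r * p * B)"

text \<open>A sign matrix moves through the word to its right end: diag(s,t) T^r = T^(str)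
  diag(s,t), and likewise for L. The exponents stay nonzero.\<close>

lemma alternating_signs:
  assumes "alternating p q A B C D" "\<bar>s\<bar> = 1" "\<bar>t\<bar> = 1"
  shows "alternating p q (s * A) (s * B) (t * C) (t * D)"
  using assms
proof (induction rule: alternating.induct)
  case (diag s' t' q)
  then show ?case
    by (simp add: alternating.diag abs_mult)
next
  case (upper A B C D r)
  have "t = 1 \<or> t = - 1"
    using upper.prems by linarith
  moreover have "alternating p False (s * A + s * t * r * (t * C)) (s * B + s * t * r * (t * D)) (t * C) (t * D)"
    using upper by (intro alternating.upper) auto
  ultimately show ?case
    by (auto simp: algebra_simps)
next
  case (lower A B C D r)
  have "s = 1 \<or> s = - 1"
    using lower.prems by linarith
  moreover have "alternating p True (s * A) (s * B) (t * C + s * t * r * p * (s * A)) (t * D + s * t * r * p * (s * B))"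
    using lower by (intro alternating.lower) auto
  ultimately show ?case
    by (auto simp: algebra_simps)
qed

text \<open>A leading power of T merges with the new one, and if the exponents cancel the word loses
  its first letter; hence the flag of the result is only existential.\<close>

lemma alternating_upper:
  assumes "alternating p q A B C D"
  shows "\<exists>q'. alternating p q' (A + r * C) (B + r * D) C D"
proof (cases "r = 0")
  case True
  then show ?thesis using assms by auto
next
  case False
  show ?thesis
    using assms
  proof cases
    case diag
    then show ?thesis
      using alternating.upper[OF alternating.diag] False by metis
  next
    case (upper A' B' r')
    then have eq: "A + r * C = A' + (r' + r) * C" "B + r * D = B' + (r' + r) * D"
      by (simp_all add: algebra_simps)
    show ?thesis
      unfolding eq using upper(4) alternating.upper[of p A' B' C D "r' + r"]
      by (cases "r' + r = 0") auto
  next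
    case lower
    then show ?thesis
      using assms alternating.upper False by metis
  qed
qed

lemma alternating_lower:
  assumes "alternating p q A B C D"
  shows "\<exists>q'. alternating p q' A B (C + r * p * A) (D + r * p * B)"
proof (cases "r = 0")
  case True
  then show ?thesis using assms by auto
next
  case False
  show ?thesis
    using assms
  proof cases
    case diag
    then show ?thesis
      using alternating.lower[OF alternating.diag] False by metis
  next
    case upper
    then show ?thesis
      using assms alternating.lower False by metis
  next
    case (lower C' D' r')
    then have eq: "C + r * p * A = C' + (r' + r) * p * A" "D + r * p * B = D' + (r' + r) * p * B"
      by (simp_all add: algebra_simps)
    show ?thesis
      unfolding eq using lower(4) alternating.lower[of p A B C' D' "r' + r"]
      by (cases "r' + r = 0") auto
  qed
qed

text \<open>As p \<ge> 4, the hypothesis gives |u| \<le> |v|/2, while |r v| \<ge> |v|; the triangle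
  inequality leaves at least |v|/2.\<close>

lemma cone_upper:
  fixes p u v r :: int
  assumes "p \<ge> 4" "p * \<bar>u\<bar> \<le> 2 * \<bar>v\<bar>" "r \<noteq> 0"
  shows "\<bar>v\<bar> \<le> 2 * \<bar>u + r * v\<bar>"
proof -
  have "4 * \<bar>u\<bar> \<le> p * \<bar>u\<bar>"
    using assms(1) by (intro mult_right_mono) auto
  moreover have "1 * \<bar>v\<bar> \<le> \<bar>r\<bar> * \<bar>v\<bar>"
    using assms(3) by (intro mult_right_mono) auto
  moreover have "\<bar>r\<bar> * \<bar>v\<bar> \<le> \<bar>u + r * v\<bar> + \<bar>u\<bar>"
    unfolding abs_mult[symmetric] by linarith
  ultimately show ?thesis
    using assms(2) by linarith
qed

lemma cone_lower:
  fixes p u v r :: int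
  assumes "p \<ge> 4" "\<bar>v\<bar> \<le> 2 * \<bar>u\<bar>" "r \<noteq> 0"
  shows "p * \<bar>u\<bar> \<le> 2 * \<bar>v + r * p * u\<bar>"
proof -
  have "4 * \<bar>u\<bar> \<le> p * \<bar>u\<bar>"
    using assms(1) by (intro mult_right_mono) auto
  moreover have "1 * (p * \<bar>u\<bar>) \<le> \<bar>r\<bar> * (p * \<bar>u\<bar>)"
    using assms(1,3) by (intro mult_right_mono) auto
  moreover have "\<bar>r\<bar> * (p * \<bar>u\<bar>) = \<bar>r * p * u\<bar>"
    using assms(1) by (simp add: abs_mult)
  moreover have "\<bar>r * p * u\<bar> \<le> \<bar>v + r * p * u\<bar> + \<bar>v\<bar>"
    by linarith
  ultimately show ?thesis
    using assms(2) by linarith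
qed

text \<open>The sign matrices are set apart because their columns lie in different cones, whereas a
  single power of T or L brings both columns into the same cone. From then on the cone lemmas
  apply.\<close>

lemma alternating_columns:
  assumes "alternating p q A B C D" "p \<ge> 4"
  shows "(B = 0 \<and> C = 0 \<and> \<bar>A\<bar> = 1 \<and> \<bar>D\<bar> = 1) \<or>
    (if q then p * \<bar>A\<bar> \<le> 2 * \<bar>C\<bar> \<and> p * \<bar>B\<bar> \<le> 2 * \<bar>D\<bar> else \<bar>C\<bar> \<le> 2 * \<bar>A\<bar> \<and> \<bar>D\<bar> \<le> 2 * \<bar>B\<bar>)"
  using assms
proof (induction rule: alternating.induct)
  case diag
  then show ?case by simp
next
  case (upper A B C D r)
  \<comment> \<open>Needed when the shorter word is a sign matrix: its second column becomes
    \<open>(r * D, D)\<close>.\<close>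
  have r: "\<bar>r\<bar> \<ge> 1"
    using upper.hyps by linarith
  show ?case
    using upper r cone_upper[of p A C r] cone_upper[of p B D r] by (auto simp: abs_mult)
next
  case (lower A B C D r)
  have "1 * p \<le> \<bar>r\<bar> * p"
    using lower.hyps lower.prems by (intro mult_right_mono) auto
  then show ?case
    using lower cone_lower[of p C A r] cone_lower[of p D B r] by (auto simp: abs_mult)
qed

lemma alternating_cone:
  assumes "alternating p q A B C D" "p \<ge> 4"
  shows "\<bar>C\<bar> \<le> 2 * \<bar>A\<bar> \<or> p * \<bar>B\<bar> \<le> 2 * \<bar>D\<bar>"
  using alternating_columns[OF assms] by (auto split: if_splits)

section \<open>The cone condition on the image of the star map for p \<ge> 4\<close>

lemma goeritz_gen_matrix_involution:
  assumes "h \<in> {Alpha, Beta, Gamma, Sigma}"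
  shows "goeritz_gen_matrix p h ** goeritz_gen_matrix p h = mat 1"
  using assms
  by (auto simp: vec_eq_iff forall_4 matrix_matrix_mult_def sum_4 mat_def)

lemma goeritz_cone:
  assumes p: "p \<ge> 4" and basis: "surface_basis p V W B"
    and Cho: "has_presentation (goeritz_group p V W) (goeritz_gens p) R gen"
    and star_gen: "\<And>h. h \<in> goeritz_gens p \<Longrightarrow> star_map p V W B (gen h) = goeritz_gen_matrix p h"
    and g: "g \<in> carrier (goeritz_group p V W)"
  defines "N \<equiv> star_map p V W B g"
  shows "\<bar>N$2$1\<bar> \<le> 2 * \<bar>N$1$1\<bar> \<or> int p * \<bar>N$1$2\<bar> \<le> 2 * \<bar>N$2$2\<bar>"
proof -
  have gens: "goeritz_gens p = {Alpha, Beta, Gamma, Sigma}"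
    using p by (simp add: goeritz_gens_def)
  \<comment> \<open>With a vanishing lower left block, the upper left block of a product depends
    only on the upper left blocks of the factors.\<close>
  define P :: "int^4^4 \<Rightarrow> bool" where "P N \<longleftrightarrow>
    N$3$1 = 0 \<and> N$3$2 = 0 \<and> N$4$1 = 0 \<and> N$4$2 = 0 \<and>
    (\<exists>q. alternating (int p) q (N$1$1) (N$1$2) (N$2$1) (N$2$2))" for N
  have step: "P (goeritz_gen_matrix p h ** N)" if h: "h \<in> goeritz_gens p" and N: "P N" for h N
  proof -
    obtain q where q: "alternating (int p) q (N$1$1) (N$1$2) (N$2$1) (N$2$2)"
      using N by (auto simp: P_def)
    from alternating_upper[OF this, of 1] alternating_lower[OF this, of 1]
    obtain q1 q2 where
      u: "alternating (int p) q1 (N$1$1 + N$2$1) (N$1$2 + N$2$2) (N$2$1) (N$2$2)" and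
      l: "alternating (int p) q2 (N$1$1) (N$1$2) (N$2$1 + p * N$1$1) (N$2$2 + p * N$1$2)"
      by auto
    \<comment> \<open>The effects of \<open>Alpha\<close>, \<open>Beta\<close>, \<open>Gamma\<close>
      and \<open>Sigma\<close>, whose upper left blocks are -I, diag(1,-1), diag(1,-1) T and
      diag(1,-1) L.\<close>
    have "alternating p q (- N$1$1) (- N$1$2) (- N$2$1) (- N$2$2)"
      "alternating p q (N$1$1) (N$1$2) (- N$2$1) (- N$2$2)"
      "alternating p q1 (N$1$1 + N$2$1) (N$1$2 + N$2$2) (- N$2$1) (- N$2$2)"
      "alternating p q2 (N$1$1) (N$1$2) (- N$2$1 - p * N$1$1) (- N$2$2 - p * N$1$2)"
      using alternating_signs[OF q, of "-1" "-1"] alternating_signs[OF q, of 1 "-1"]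
        alternating_signs[OF u, of 1 "-1"] alternating_signs[OF l, of 1 "-1"]
      by (simp_all add: algebra_simps)
    then show ?thesis
      using h N unfolding gens P_def
      by (auto simp: matrix_matrix_mult_def sum_4 mat_def minus_diff_commute)
  qed
  have one: "P (mat 1)"
    using alternating.diag[of 1 1] by (auto simp: P_def mat_def)
  have "P N"
    unfolding N_def
    by (rule star_map_goeritz_induct[where P = P and M = "goeritz_gen_matrix p",
          OF basis Cho star_gen _ one step g])
       (simp_all add: gens goeritz_gen_matrix_involution)
  then show ?thesis
    using alternating_cone[of "int p"] p unfolding P_def by fastforce
qed

text \<open>The difference \<open>p\<^sup>2\<bar>lm\<bar> - 4\<bar>uw\<bar>\<close> is bounded above because \<open>uw\<close> is close to \<open>lmp\<close> and \<open>p < 4\<close>,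
  while failure of both inequalities bounds it below.\<close>

lemma small_cone:
  fixes p k l m n \<Delta> :: int
  assumes p: "p = 2 \<or> p = 3" and \<Delta>: "\<bar>\<Delta>\<bar> = 1"
    and det: "\<Delta> = (k * p + 1) * (n * p + \<Delta>) - l * (m * p)"
  shows "\<bar>m * p\<bar> \<le> 2 * \<bar>k * p + 1\<bar> \<or> p * \<bar>l\<bar> \<le> 2 * \<bar>n * p + \<Delta>\<bar>"
proof (rule ccontr)
  define u w where "u = k * p + 1" and "w = n * p + \<Delta>"
  assume "\<not> ?thesis"
  then have m: "2 * \<bar>u\<bar> + 1 \<le> p * \<bar>m\<bar>" and l: "2 * \<bar>w\<bar> + 1 \<le> p * \<bar>l\<bar>"
    using p by (auto simp: u_def w_def abs_mult)
  \<comment> \<open>Both are congruent to 1 or -1 modulo p.\<close>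
  have "u \<noteq> 0" "w \<noteq> 0"
    using p \<Delta> unfolding u_def w_def by presburger+
  then have uw: "\<bar>u\<bar> \<ge> 1" "\<bar>w\<bar> \<ge> 1"
    by linarith+
  have "m \<noteq> 0" "l \<noteq> 0"
    using m l by auto
  then have lm: "\<bar>l * m\<bar> \<ge> 1"
    by (simp add: zero_less_abs_iff int_one_le_iff_zero_less)
  have "u * w = \<Delta> + p * (l * m)"
    using det by (simp add: u_def w_def algebra_simps)
  then have "\<bar>u * w\<bar> \<ge> p * \<bar>l * m\<bar> - 1"
    using p \<Delta> by (auto simp: abs_if split: if_splits)
  moreover have "(2 * \<bar>u\<bar> + 1) * (2 * \<bar>w\<bar> + 1) \<le> (p * \<bar>m\<bar>) * (p * \<bar>l\<bar>)"
    using m l p by (intro mult_mono) auto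
  then have "4 * \<bar>u * w\<bar> + 2 * \<bar>u\<bar> + 2 * \<bar>w\<bar> + 1 \<le> p * p * \<bar>l * m\<bar>"
    by (simp add: algebra_simps abs_mult)
  \<comment> \<open>Together, p^2 |l m| \<ge> 4 (p |l m| - 1) + 5 = 4 p |l m| + 1, which p < 4
    excludes.\<close>
  ultimately show False
    using p uw lm by auto
qed

section \<open>Recovering the matrix entries from the two vectors\<close>

theorem theorem4p4:
  fixes p :: nat
    and V W :: "lens_point set"
    and B :: "4 \<Rightarrow> lens_point chain set"
    and gen :: "goeritz_gen \<Rightarrow> (lens_point \<Rightarrow> lens_point) set"
    and g :: "(lens_point \<Rightarrow> lens_point) set"
    and \<epsilon> \<omega> \<Delta> k l m n a x b y a' x' b' y' s s' \<delta> \<delta>' :: int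
    and c d e f :: real
  assumes p: "p \<ge> 2"
    and splitting: "genus2_stabilization p V W"
    and basis: "surface_basis p V W B"
    and Cho: "has_presentation (goeritz_group p V W) (goeritz_gens p) (goeritz_relators p) gen"
    and star_gen: "\<forall>h \<in> goeritz_gens p. star_map p V W B (gen h) = goeritz_gen_matrix p h"
    and eps: "\<epsilon> = (if p = 3 then -1 else 1)"
    and s: "s = a * int p + \<epsilon> * b"
    and s': "s' = a' * int p + \<epsilon> * b'"
    and delta: "\<delta> = b * s + x * y * int p" "\<delta> \<noteq> 0"
    and delta': "\<delta>' = b' * s' + x' * y' * int p" "\<delta>' \<noteq> 0"
    and g: "g \<in> carrier (goeritz_group p V W)"
    and gv: "star_map p V W B g *v vector [a, x, b, y] = vector [a', x', b', y']"
    and omega: "\<omega> \<in> {1, -1}"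
    and Delta: "\<Delta> \<in> {1, -1}"
      "\<Delta> = det (vector [vector [k * int p + 1, l],
                       vector [m * int p, n * int p + \<Delta>]] :: int^2^2)"
    and form: "star_map p V W B g = (\<chi> i j. \<omega> * (vector
       [vector [k * int p + 1, l, \<epsilon> * (k - \<Delta> * n), \<epsilon> * \<Delta> * m],
        vector [m * int p, n * int p + \<Delta>, \<epsilon> * m, 0],
        vector [0, 0, \<Delta> * n * int p + 1, - \<Delta> * m * int p],
        vector [0, 0, - \<Delta> * l, \<Delta> * (k * int p + 1)]] :: int^4^4) $ i $ j)"
    and c: "c = real_of_int (\<Delta> * b * x' - b' * x) / real_of_int \<delta>"
    and d: "d = real_of_int (b * s' + \<Delta> * x * y' * int p) / real_of_int \<delta>"
    and e: "e = real_of_int (b' * s + \<Delta> * x' * y * int p) / real_of_int \<delta>"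
    and f: "f = real_of_int (y * s' - \<Delta> * y' * s) / real_of_int \<delta>"
  shows
    "(a', x', b', y') = (\<omega> * a, \<omega> * (\<Delta> * x), \<omega> * b, \<omega> * (\<Delta> * y))
   \<or> (\<exists>l::int. l \<noteq> 0 \<and>
        (a', x', b', y') =
          (\<omega> * (a + l * x), \<omega> * (\<Delta> * x), \<omega> * b, \<omega> * (\<Delta> * (y - l * b))))
   \<or> (\<exists>m::int. m \<noteq> 0 \<and>
        (a', x', b', y') =
          (\<omega> * (a + \<Delta> * \<epsilon> * m * y), \<omega> * (\<Delta> * x + m * s),
           \<omega> * (b - \<Delta> * m * int p * y), \<omega> * (\<Delta> * y)))
   \<or> (real_of_int a', real_of_int x', real_of_int b', real_of_int y') =
        (\<omega> * (a + c * f * s) + f * x + \<epsilon> * c * y,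
         \<Delta> * (\<omega> * x + c * s),
         \<omega> * b - c * p * y,
         \<Delta> * (\<omega> * (c * f * p + 1) * y - f * b))
   \<or> (p = 2 \<and> (c = 0 \<or> f = 0) \<and>
        (real_of_int a', real_of_int x', real_of_int b', real_of_int y') =
          (- \<omega> * a + f * x + c * y,
           - \<Delta> * (\<omega> * x - c * s),
           - \<omega> * b - 2 * c * y,
           - \<Delta> * (\<omega> * y + f * b)))
   \<or> ((real_of_int a', real_of_int x', real_of_int b', real_of_int y') =
          (d * a + f * x + \<epsilon> * ((d - e) / p) * b + \<epsilon> * c * y,
           \<Delta> * (e * x + c * s),
           e * b - c * p * y,
           \<Delta> * (d * y - f * b)) \<and>
        (\<bar>c * p\<bar> \<le> 2 * \<bar>d\<bar> \<or> p * \<bar>f\<bar> \<le> 2 * \<bar>e\<bar>))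
   \<or> (real_of_int a', real_of_int x', real_of_int b', real_of_int y') =
        (\<omega> * (a + x) + \<epsilon> * c * (y - b),
         \<Delta> * ((c * p + \<omega>) * x + c * s),
         (c * p + \<omega>) * b - c * p * y,
         real_of_int \<Delta> * real_of_int \<omega> * (real_of_int y - real_of_int b))"
proof -
  have \<Delta>: "\<bar>\<Delta>\<bar> = 1" and [simp]: "\<Delta> * \<Delta> = 1" "\<omega> * \<omega> = 1" and \<omega>: "\<bar>\<omega>\<bar> = 1"
    using Delta(1) omega by auto
  have [simp]: "\<Delta> * (\<Delta> * z) = z" "\<omega> * (\<omega> * z) = z" for z :: int
    by (simp_all flip: mult.assoc)
  have [simp]: "\<epsilon> * \<epsilon> = 1"
    by (simp add: eps)
  have det: "\<Delta> = (k * p + 1) * (n * p + \<Delta>) - l * (m * p)"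
    using Delta(2) by (simp add: det_2)
  have a': "a' = \<omega> * ((k * p + 1) * a + l * x + \<epsilon> * (k - \<Delta> * n) * b + \<epsilon> * \<Delta> * m * y)"
    and x': "x' = \<omega> * (m * s + (n * p + \<Delta>) * x)"
    and b': "b' = \<omega> * ((\<Delta> * n * p + 1) * b - \<Delta> * m * p * y)"
    and y': "y' = \<omega> * (- \<Delta> * l * b + \<Delta> * (k * p + 1) * y)"
    using gv unfolding form s
    by (auto simp: vec_eq_iff forall_4 matrix_vector_mult_def sum_4 algebra_simps)
  \<comment> \<open>In \<open>s'\<close> the terms in \<open>y\<close> cancel and those in
    \<open>a\<close> and \<open>b\<close> recombine to \<open>s\<close>.\<close>
  have s'_eq: "s' = \<omega> * ((k * p + 1) * s + l * p * x)"
    unfolding s' a' b' s by (simp add: algebra_simps)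
  \<comment> \<open>The \<open>b * x\<close> terms cancel since \<Delta> squares to 1, leaving a
    multiple of \<delta>. The numerators of \<open>d\<close>, \<open>e\<close> and \<open>f\<close>
    collapse in the same way.\<close>
  have "\<Delta> * b * x' - b' * x = (\<omega> * \<Delta> * m) * \<delta>"
    unfolding x' b' delta by (simp add: algebra_simps)
  then have c_eq: "c = real_of_int (\<omega> * \<Delta> * m)"
    using delta(2) unfolding c by simp
  have "b * s' + \<Delta> * x * y' * p = (\<omega> * (k * p + 1)) * \<delta>"
    unfolding s'_eq y' delta by (simp add: algebra_simps)
  then have d_eq: "d = real_of_int (\<omega> * (k * p + 1))"
    using delta(2) unfolding d by simp
  have "b' * s + \<Delta> * x' * y * p = (\<omega> * (\<Delta> * n * p + 1)) * \<delta>"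
    unfolding x' b' delta by (simp add: algebra_simps)
  then have e_eq: "e = real_of_int (\<omega> * (\<Delta> * n * p + 1))"
    using delta(2) unfolding e by simp
  have "y * s' - \<Delta> * y' * s = (\<omega> * l) * \<delta>"
    unfolding s'_eq y' delta by (simp add: algebra_simps)
  then have f_eq: "f = real_of_int (\<omega> * l)"
    using delta(2) unfolding f by simp
  have "\<bar>m * p\<bar> \<le> 2 * \<bar>k * p + 1\<bar> \<or> p * \<bar>l\<bar> \<le> 2 * \<bar>n * p + \<Delta>\<bar>"
  proof (cases "p \<ge> 4")
    case True
    show ?thesis
      using goeritz_cone[OF True basis Cho _ g] star_gen \<omega>
      unfolding form by (simp add: abs_mult)
  next
    case False
    then show ?thesis
      using p by (intro small_cone \<Delta> det) auto
  qed
  \<comment> \<open>The cone condition speaks of the matrix entry, \<open>e\<close> of its product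
    with \<Delta>.\<close>
  moreover have "\<bar>n * p + \<Delta>\<bar> = \<bar>\<Delta> * n * p + 1\<bar>"
    using Delta(1) by auto
  ultimately have "\<bar>\<omega> * \<Delta> * m * p\<bar> \<le> 2 * \<bar>\<omega> * (k * p + 1)\<bar> \<or> p * \<bar>\<omega> * l\<bar> \<le> 2 * \<bar>\<omega> * (\<Delta> * n * p + 1)\<bar>"
    using \<Delta> \<omega> by (simp add: abs_mult)
  then have "real_of_int \<bar>\<omega> * \<Delta> * m * p\<bar> \<le> real_of_int (2 * \<bar>\<omega> * (k * p + 1)\<bar>) \<or>
      real_of_int (p * \<bar>\<omega> * l\<bar>) \<le> real_of_int (2 * \<bar>\<omega> * (\<Delta> * n * p + 1)\<bar>)"
    unfolding of_int_le_iff .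
  then have ineq: "\<bar>c * p\<bar> \<le> 2 * \<bar>d\<bar> \<or> p * \<bar>f\<bar> \<le> 2 * \<bar>e\<bar>"
    unfolding c_eq d_eq e_eq f_eq by simp
  \<comment> \<open>The summands 1 in \<open>d\<close> and \<open>e\<close> cancel, so the division
    by \<open>p\<close> is exact.\<close>
  have de: "(d - e) / p = real_of_int (\<omega> * (k - \<Delta> * n))"
    using p unfolding d_eq e_eq by (simp add: field_simps)
  have "real_of_int a' = d * a + f * x + \<epsilon> * ((d - e) / p) * b + \<epsilon> * c * y"
    unfolding de unfolding a' c_eq d_eq f_eq by (simp add: algebra_simps)
  moreover have "x' = \<Delta> * (\<omega> * (\<Delta> * n * p + 1) * x + \<omega> * \<Delta> * m * s)"
    unfolding x' by (simp add: algebra_simps)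
  then have "real_of_int x' = \<Delta> * (e * x + c * s)"
    unfolding e_eq c_eq by simp
  moreover have "real_of_int b' = e * b - c * p * y"
    unfolding b' e_eq c_eq by (simp add: algebra_simps)
  moreover have "real_of_int y' = \<Delta> * (d * y - f * b)"
    unfolding y' d_eq f_eq by (simp add: algebra_simps)
  ultimately show ?thesis
    using ineq by simp
qed

end
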